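(* Let $X$ be a topological space. (a) $X$ is homeomorphic to a path space of a tree if and only if $X$ is homeomorphic to a compact ray space of a tree. (b) $X$ is homeomorphic to a path space of a special tree if and only if $X$ is homeomorphic to a compact ray space of a special tree.
   Context: A tree is a partially ordered set $T$ with a unique minimal element (its root) such that the set of predecessors of any element is well-ordered (distinct limit nodes may have the same set of strict predecessors). It is special if it is a union of countably many antichains. A path in $T$ is a down-closed chain (thus a path is a non-splitting rooted subtree of $T$, where a rooted subtree contains the root of $T$); a ray is a path without maximal element. Identifying paths with their characteristic functions, the path space $\mathcal{P}(T)$ is the set of all paths of $T$ with the subspace topology from $2^T$ (product topology), and the ray space $\mathcal{R}(T)$ is the subspace of all rays.
   Formalization: X is assumed nonempty: the one-node tree has an empty, hence compact, ray space, while every path space contains the path consisting of the root, so both equivalences fail for the empty space, and only that space is excluded. *)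

theory Defs
  imports "HOL-Analysis.Analysis"
begin

(* An order tree is a carrier set T together with a reflexive partial order r on T, where
   (s, t) \<in> r means s \<le> t; underS r t is the set of strict predecessors of t. No condition
   is put on limits, so distinct limit nodes may have the same strict predecessors. *)

definition order_tree :: "'t set \<Rightarrow> 't rel \<Rightarrow> bool" where
  "order_tree T r \<longleftrightarrow>
     partial_order_on T r \<and>
     (\<exists>!m. m \<in> T \<and> (\<forall>s\<in>T. (s, m) \<in> r \<longrightarrow> s = m)) \<and>
     (\<forall>t\<in>T. well_order_on (underS r t) (r \<inter> (underS r t \<times> underS r t)))"

definition tree_antichain :: "'t set \<Rightarrow> 't rel \<Rightarrow> 't set \<Rightarrow> bool" where
  "tree_antichain T r A \<longleftrightarrow> A \<subseteq> T \<and> (\<forall>s\<in>A. \<forall>t\<in>A. (s, t) \<in> r \<longrightarrow> s = t)"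

definition special_tree :: "'t set \<Rightarrow> 't rel \<Rightarrow> bool" where
  "special_tree T r \<longleftrightarrow>
     order_tree T r \<and> (\<exists>\<A>. countable \<A> \<and> (\<forall>A\<in>\<A>. tree_antichain T r A) \<and> T = \<Union>\<A>)"

(* Paths are rooted subtrees. For a down-closed set, containing the root
   is the same as being nonempty. *)

definition tree_paths :: "'t set \<Rightarrow> 't rel \<Rightarrow> 't set set" where
  "tree_paths T r =
     {p. p \<subseteq> T \<and> p \<noteq> {} \<and>
         (\<forall>t\<in>p. \<forall>s\<in>T. (s, t) \<in> r \<longrightarrow> s \<in> p) \<and>
         (\<forall>s\<in>p. \<forall>t\<in>p. (s, t) \<in> r \<or> (t, s) \<in> r)}"

definition tree_rays :: "'t set \<Rightarrow> 't rel \<Rightarrow> 't set set" where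
  "tree_rays T r = {p \<in> tree_paths T r. \<not> (\<exists>m\<in>p. \<forall>t\<in>p. (m, t) \<in> r \<longrightarrow> t = m)}"

(* The Cantor cube over T, with the discrete two-point space rendered by bool. Points of a
   product topology are extensional functions, so characteristic functions are restricted to T. *)

definition cantor_cube :: "'t set \<Rightarrow> ('t \<Rightarrow> bool) topology" where
  "cantor_cube T = product_topology (\<lambda>_. discrete_topology UNIV) T"

definition char_fun :: "'t set \<Rightarrow> 't set \<Rightarrow> 't \<Rightarrow> bool" where
  "char_fun T p = restrict (\<lambda>t. t \<in> p) T"

definition path_space :: "'t set \<Rightarrow> 't rel \<Rightarrow> ('t \<Rightarrow> bool) topology" where
  "path_space T r = subtopology (cantor_cube T) (char_fun T ` tree_paths T r)"

definition ray_space :: "'t set \<Rightarrow> 't rel \<Rightarrow> ('t \<Rightarrow> bool) topology" where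
  "ray_space T r = subtopology (cantor_cube T) (char_fun T ` tree_rays T r)"

lemma topspace_path_space: "topspace (path_space T r) = char_fun T ` tree_paths T r"
  by (auto simp: path_space_def cantor_cube_def char_fun_def)

lemma topspace_ray_space: "topspace (ray_space T r) = char_fun T ` tree_rays T r"
  by (auto simp: ray_space_def cantor_cube_def char_fun_def)

end

(* A path space is compact, being closed in the Cantor cube. Replacing every node of a tree by a
   copy of the natural numbers turns the paths of the tree into the rays of the new one.
   Conversely, discard the nodes that lie on no ray and contract, for every remaining node, the
   edge to one chosen successor: a ray is determined by the path that it leaves behind, and a
   path with a greatest node comes from the ray that follows the chosen successors forever. Both
   maps are continuous bijections between subspaces of Cantor cubes, so they are homeomorphisms
   as soon as their domain is compact. *)

theory Submission
  imports Defs
begin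

section \<open>Order trees\<close>

text \<open>Replaces the well-orders below single nodes by one global well-foundedness condition,
  which is easier to use and to verify. A set \<open>Q\<close> containing \<open>x\<close> either
  has nothing strictly below \<open>x\<close>, so that \<open>x\<close> is minimal in it, or meets
  \<open>underS r x\<close>. In the second case a minimum of the intersection is minimal in all of
  \<open>Q\<close>, because whatever lies strictly below it lies strictly below \<open>x\<close>
  too.\<close>

lemma order_tree_iff:
  "order_tree T r \<longleftrightarrow>
     partial_order_on T r \<and> wf (r - Id) \<and>
     (\<forall>t u v. (u, t) \<in> r \<longrightarrow> (v, t) \<in> r \<longrightarrow> (u, v) \<in> r \<or> (v, u) \<in> r) \<and>
     (\<exists>m\<in>T. \<forall>t\<in>T. (m, t) \<in> r)"
  (is "?L \<longleftrightarrow> ?P \<and> ?W \<and> ?C \<and> ?R")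
proof
  assume L: ?L
  then have P: ?P
    and U: "\<exists>!m. m \<in> T \<and> (\<forall>s\<in>T. (s, m) \<in> r \<longrightarrow> s = m)"
    and O: "\<And>t. t \<in> T \<Longrightarrow> well_order_on (underS r t) (r \<inter> (underS r t \<times> underS r t))"
    by (auto simp: order_tree_def)
  from P have sub: "r \<subseteq> T \<times> T" and rfl: "\<And>x. x \<in> T \<Longrightarrow> (x, x) \<in> r"
    and tr: "trans r" and as: "antisym r"
    by (auto simp: partial_order_on_def preorder_on_def refl_on_def)
  have W: ?W
  proof (rule wfI_min)
    fix x and Q :: "'a set" assume "x \<in> Q"
    show "\<exists>z\<in>Q. \<forall>y. (y, z) \<in> r - Id \<longrightarrow> y \<notin> Q"
    proof (cases "Q \<inter> underS r x = {}")
      case True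
      then show ?thesis
        using \<open>x \<in> Q\<close> by (auto simp: underS_def)
    next
      case False
      then have "x \<in> T" using sub by (auto simp: underS_def)
      then have "wf (r \<inter> (underS r x \<times> underS r x) - Id)"
        using O by (auto simp: well_order_on_def)
      with False obtain z where z: "z \<in> Q \<inter> underS r x"
        and min: "\<And>y. (y, z) \<in> r \<inter> (underS r x \<times> underS r x) - Id \<Longrightarrow> y \<notin> Q \<inter> underS r x"
        by (metis equals0I wfE_min)
      have "y \<notin> Q" if y: "(y, z) \<in> r - Id" for y
      proof -
        have "y \<in> underS r x"
          using y z tr as unfolding underS_def trans_def antisym_def by blast
        with min[of y] y z show ?thesis by auto
      qed
      then show ?thesis using z by blast
    qed
  qed
  have C: ?C
  proof (intro allI impI)
    fix t u v assume uv: "(u, t) \<in> r" "(v, t) \<in> r"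
    have tT: "t \<in> T" using uv sub by auto
    have uT: "u \<in> T" using uv sub by auto
    show "(u, v) \<in> r \<or> (v, u) \<in> r"
    proof (cases "u = t \<or> v = t \<or> u = v")
      case True
      then show ?thesis using uv rfl uT by auto
    next
      case False
      then have "u \<in> underS r t" "v \<in> underS r t" using uv by (auto simp: underS_def)
      then show ?thesis
        using O[OF tT] False by (auto simp: well_order_on_def linear_order_on_def total_on_def)
    qed
  qed
  have R: ?R
  proof -
    obtain m where m: "m \<in> T" and mu: "\<And>z. z \<in> T \<Longrightarrow> \<forall>s\<in>T. (s, z) \<in> r \<longrightarrow> s = z \<Longrightarrow> z = m"
      using U by blast
    have "(m, t) \<in> r" if "t \<in> T" for t
    proof -
      \<comment> \<open>A minimal element among the nodes below \<open>t\<close> is minimal in all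
        of \<open>T\<close>, so it is the unique minimal node \<open>m\<close>; this turns minimal
        into least.\<close>
      have "t \<in> {s. (s, t) \<in> r}" using rfl that by auto
      then obtain z where z: "(z, t) \<in> r" and min: "\<And>y. (y, z) \<in> r - Id \<Longrightarrow> (y, t) \<notin> r"
        using W by (metis mem_Collect_eq wfE_min)
      have "\<forall>s\<in>T. (s, z) \<in> r \<longrightarrow> s = z"
        using min z tr unfolding trans_def by blast
      then have "z = m" using mu z sub by auto
      with z show ?thesis by simp
    qed
    with m show ?thesis by blast
  qed
  show "?P \<and> ?W \<and> ?C \<and> ?R" using P W C R by blast
next
  assume A: "?P \<and> ?W \<and> ?C \<and> ?R"
  then obtain m where m: "m \<in> T" "\<And>t. t \<in> T \<Longrightarrow> (m, t) \<in> r" by blast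
  from A have sub: "r \<subseteq> T \<times> T" and rfl: "\<And>x. x \<in> T \<Longrightarrow> (x, x) \<in> r"
    and tr: "trans r" and as: "antisym r"
    by (auto simp: partial_order_on_def preorder_on_def refl_on_def)
  have U: "\<exists>!m. m \<in> T \<and> (\<forall>s\<in>T. (s, m) \<in> r \<longrightarrow> s = m)"
    using m as unfolding antisym_def by (intro ex1I[of _ m]) blast+
  have "well_order_on (underS r t) (r \<inter> (underS r t \<times> underS r t))" for t
  proof -
    have "r \<inter> (underS r t \<times> underS r t) \<subseteq> underS r t \<times> underS r t" by blast
    moreover have "refl_on (underS r t) (r \<inter> (underS r t \<times> underS r t))"
      using rfl sub by (auto simp: refl_on_def underS_def)
    moreover have "trans (r \<inter> (underS r t \<times> underS r t))"
      using tr unfolding trans_def by blast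
    moreover have "antisym (r \<inter> (underS r t \<times> underS r t))"
      using as unfolding antisym_def by blast
    moreover have "total_on (underS r t) (r \<inter> (underS r t \<times> underS r t))"
      using A unfolding total_on_def underS_def by blast
    moreover have "wf (r \<inter> (underS r t \<times> underS r t) - Id)"
      using A by (blast intro: wf_subset)
    ultimately show ?thesis
      by (auto simp: order_on_defs)
  qed
  with A U show ?L by (auto simp: order_tree_def)
qed

lemma order_treeD:
  assumes "order_tree T r"
  shows order_tree_dom: "(x, y) \<in> r \<Longrightarrow> x \<in> T" "(x, y) \<in> r \<Longrightarrow> y \<in> T"
    and order_tree_refl: "x \<in> T \<Longrightarrow> (x, x) \<in> r"
    and order_tree_trans: "(x, y) \<in> r \<Longrightarrow> (y, z) \<in> r \<Longrightarrow> (x, z) \<in> r"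
    and order_tree_antisym: "(x, y) \<in> r \<Longrightarrow> (y, x) \<in> r \<Longrightarrow> x = y"
    and order_tree_wf: "wf (r - Id)"
    and order_tree_comparable: "(x, z) \<in> r \<Longrightarrow> (y, z) \<in> r \<Longrightarrow> (x, y) \<in> r \<or> (y, x) \<in> r"
    and order_tree_root: "\<exists>m\<in>T. \<forall>t\<in>T. (m, t) \<in> r"
proof -
  have *: "r \<subseteq> T \<times> T" "refl_on T r" "trans r" "antisym r"
    using assms by (simp_all add: order_tree_iff partial_order_on_def preorder_on_def)
  show "(x, y) \<in> r \<Longrightarrow> x \<in> T" "(x, y) \<in> r \<Longrightarrow> y \<in> T" "x \<in> T \<Longrightarrow> (x, x) \<in> r"
    using * by (auto simp: refl_on_def)
  show "(x, y) \<in> r \<Longrightarrow> (y, z) \<in> r \<Longrightarrow> (x, z) \<in> r"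
    using * by (blast dest: transD)
  show "(x, y) \<in> r \<Longrightarrow> (y, x) \<in> r \<Longrightarrow> x = y"
    using * by (blast dest: antisymD)
  show "wf (r - Id)" "(x, z) \<in> r \<Longrightarrow> (y, z) \<in> r \<Longrightarrow> (x, y) \<in> r \<or> (y, x) \<in> r"
    "\<exists>m\<in>T. \<forall>t\<in>T. (m, t) \<in> r"
    using assms unfolding order_tree_iff by blast+
qed

lemma order_treeI:
  assumes "\<And>x y. (x, y) \<in> r \<Longrightarrow> x \<in> T \<and> y \<in> T"
    and "\<And>x. x \<in> T \<Longrightarrow> (x, x) \<in> r"
    and "\<And>x y z. (x, y) \<in> r \<Longrightarrow> (y, z) \<in> r \<Longrightarrow> (x, z) \<in> r"
    and "\<And>x y. (x, y) \<in> r \<Longrightarrow> (y, x) \<in> r \<Longrightarrow> x = y"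
    and "wf (r - Id)"
    and "\<And>x y z. (x, z) \<in> r \<Longrightarrow> (y, z) \<in> r \<Longrightarrow> (x, y) \<in> r \<or> (y, x) \<in> r"
    and "m \<in> T" "\<And>t. t \<in> T \<Longrightarrow> (m, t) \<in> r"
  shows "order_tree T r"
  unfolding order_tree_iff
proof (intro conjI)
  show "partial_order_on T r"
    unfolding partial_order_on_def preorder_on_def
  proof (intro conjI)
    show "r \<subseteq> T \<times> T" using assms(1) by auto
    show "refl_on T r" using assms(2) by (simp add: refl_on_def)
    show "trans r" using assms(3) by (rule transI)
    show "antisym r" using assms(4) by (rule antisymI)
  qed
  show "\<forall>t u v. (u, t) \<in> r \<longrightarrow> (v, t) \<in> r \<longrightarrow> (u, v) \<in> r \<or> (v, u) \<in> r"
    using assms(6) by blast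
  show "\<exists>m\<in>T. \<forall>t\<in>T. (m, t) \<in> r"
    using assms(7,8) by blast
qed (rule assms(5))

lemma tree_pathsD:
  assumes "p \<in> tree_paths T r"
  shows "p \<subseteq> T" "p \<noteq> {}" "t \<in> p \<Longrightarrow> s \<in> T \<Longrightarrow> (s, t) \<in> r \<Longrightarrow> s \<in> p"
    "s \<in> p \<Longrightarrow> t \<in> p \<Longrightarrow> (s, t) \<in> r \<or> (t, s) \<in> r"
  using assms by (auto simp: tree_paths_def)

lemma root_in_path:
  assumes "p \<in> tree_paths T r" "m \<in> T" "\<And>t. t \<in> T \<Longrightarrow> (m, t) \<in> r"
  shows "m \<in> p"
  using assms unfolding tree_paths_def by blast

section \<open>Subspaces of Cantor cubes\<close>

lemma compact_space_cantor_cube: "compact_space (cantor_cube T)"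
  by (simp add: cantor_cube_def compact_space_product_topology compact_space_discrete_topology)

lemma Hausdorff_space_cantor_cube: "Hausdorff_space (cantor_cube T)"
  by (simp add: cantor_cube_def Hausdorff_space_product_topology)

text \<open>On characteristic functions, pulling sets back along \<open>g\<close> is precomposition
  with \<open>g\<close>. Every coordinate of this map is a projection of the first cube, so the map
  is continuous; from a compact space to a Hausdorff space it is closed, and a closed continuous
  bijection is a homeomorphism. Both constructions below are such pullbacks: along the projection
  \<open>b\<close>, and along an inclusion of nodes.\<close>

lemma cube_subspaces_homeomorphic:
  assumes compact: "compact_space (subtopology (cantor_cube S) (char_fun S ` A))"
    and A: "\<And>p. p \<in> A \<Longrightarrow> p \<subseteq> S"
    and B: "\<And>q. q \<in> B \<Longrightarrow> q \<subseteq> T"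
    and g: "\<And>t. t \<in> T \<Longrightarrow> g t \<in> S"
    and bij: "bij_betw (\<lambda>p. {t \<in> T. g t \<in> p}) A B"
  shows "subtopology (cantor_cube S) (char_fun S ` A)
           homeomorphic_space subtopology (cantor_cube T) (char_fun T ` B)"
proof -
  let ?X = "subtopology (cantor_cube S) (char_fun S ` A)"
  let ?Y = "subtopology (cantor_cube T) (char_fun T ` B)"
  define f :: "('a \<Rightarrow> bool) \<Rightarrow> 'b \<Rightarrow> bool" where "f = (\<lambda>x. restrict (\<lambda>t. x (g t)) T)"
  have f: "f (char_fun S p) = char_fun T {t \<in> T. g t \<in> p}" for p
    using g by (auto simp: f_def char_fun_def restrict_def)
  have tX: "topspace ?X = char_fun S ` A" and tY: "topspace ?Y = char_fun T ` B"
    by (auto simp: cantor_cube_def char_fun_def)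
  have inj: "p = q" if "char_fun U p = char_fun U q" "p \<subseteq> U" "q \<subseteq> U" for U :: "'c set" and p q
  proof -
    have "t \<in> p \<longleftrightarrow> t \<in> q" if "t \<in> U" for t
      using fun_cong[OF \<open>char_fun U p = char_fun U q\<close>, of t] that by (simp add: char_fun_def)
    with that show ?thesis by blast
  qed
  have img: "f ` topspace ?X = topspace ?Y"
    unfolding tX tY using bij_betw_imp_surj_on[OF bij] by (force simp: f image_image)
  have "continuous_map ?X (cantor_cube T) f"
    unfolding cantor_cube_def continuous_map_componentwise
  proof (intro conjI ballI)
    fix t assume "t \<in> T"
    then have "(\<lambda>x. f x t) = (\<lambda>x. x (g t))" by (simp add: f_def fun_eq_iff)
    moreover have "continuous_map (cantor_cube S) (discrete_topology UNIV) (\<lambda>x. x (g t))"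
      unfolding cantor_cube_def using g[OF \<open>t \<in> T\<close>] by (rule continuous_map_product_projection)
    ultimately show "continuous_map (subtopology (product_topology (\<lambda>_. discrete_topology UNIV) S)
        (char_fun S ` A)) (discrete_topology UNIV) (\<lambda>x. f x t)"
      by (simp add: cantor_cube_def continuous_map_from_subtopology)
  qed (auto simp: f_def)
  then have cont: "continuous_map ?X ?Y f"
    using img tY by (auto simp: continuous_map_in_subtopology)
  have "inj_on f (topspace ?X)"
    unfolding tX
  proof (clarsimp simp: inj_on_def f)
    fix p q assume pq: "p \<in> A" "q \<in> A"
      and "char_fun T {t \<in> T. g t \<in> p} = char_fun T {t \<in> T. g t \<in> q}"
    then have "{t \<in> T. g t \<in> p} = {t \<in> T. g t \<in> q}"
      by (auto dest: inj)
    then have "p = q"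
      using bij pq by (auto simp: bij_betw_def dest: inj_onD)
    then show "char_fun S p = char_fun S q" by simp
  qed
  moreover have "Hausdorff_space ?Y"
    by (simp add: Hausdorff_space_subtopology Hausdorff_space_cantor_cube)
  ultimately have "homeomorphic_map ?X ?Y f"
    using compact cont img
    by (simp add: bijective_closed_imp_homeomorphic_map continuous_imp_closed_map)
  then show ?thesis
    using homeomorphic_map_imp_homeomorphic_space by blast
qed

text \<open>Being a path is a conjunction of conditions on at most two coordinates each, so the
  paths form a closed subset of the compact cube. Nonemptiness alone would only be an open
  condition; for down-closed sets it is replaced by membership of the root \<open>m\<close>.\<close>

lemma compact_space_path_space:
  assumes "order_tree T r"
  shows "compact_space (path_space T r)"
proof -
  obtain m where m: "m \<in> T" "\<And>t. t \<in> T \<Longrightarrow> (m, t) \<in> r"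
    using order_tree_root[OF assms] by blast
  let ?E = "{x \<in> topspace (cantor_cube T). x m}"
  \<comment> \<open>The conditions on \<open>r\<close> stand inside the sets, so that both families
    can be indexed by all pairs of nodes; where such a condition fails, the set is the whole
    cube.\<close>
  let ?D = "\<lambda>s t. {x \<in> topspace (cantor_cube T). (s, t) \<in> r \<longrightarrow> x t \<longrightarrow> x s}"
  let ?C = "\<lambda>s t. {x \<in> topspace (cantor_cube T). (s, t) \<notin> r \<longrightarrow> (t, s) \<notin> r \<longrightarrow> \<not> (x s \<and> x t)}"
  have clopen: "closedin (cantor_cube T) {x \<in> topspace (cantor_cube T). x t}"
    "closedin (cantor_cube T) {x \<in> topspace (cantor_cube T). \<not> x t}" if "t \<in> T" for t
  proof -
    have "continuous_map (cantor_cube T) (discrete_topology UNIV) (\<lambda>x. x t)"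
      unfolding cantor_cube_def using that by (rule continuous_map_product_projection)
    from closedin_continuous_map_preimage[OF this, of "{True}"]
      closedin_continuous_map_preimage[OF this, of "{False}"]
    show "closedin (cantor_cube T) {x \<in> topspace (cantor_cube T). x t}"
      "closedin (cantor_cube T) {x \<in> topspace (cantor_cube T). \<not> x t}" by simp_all
  qed
  have whole: "closedin (cantor_cube T) {x \<in> topspace (cantor_cube T). True}" by simp
  have D: "closedin (cantor_cube T) (?D s t)" if "s \<in> T" "t \<in> T" for s t
  proof (cases "(s, t) \<in> r")
    case True
    then have "?D s t = {x \<in> topspace (cantor_cube T). \<not> x t} \<union> {x \<in> topspace (cantor_cube T). x s}"
      by blast
    then show ?thesis using clopen that by (simp add: closedin_Un)
  qed (use whole in simp)
  have C: "closedin (cantor_cube T) (?C s t)" if "s \<in> T" "t \<in> T" for s t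
  proof (cases "(s, t) \<notin> r \<and> (t, s) \<notin> r")
    case True
    then have "?C s t = {x \<in> topspace (cantor_cube T). \<not> x s} \<union> {x \<in> topspace (cantor_cube T). \<not> x t}"
      by blast
    then show ?thesis using clopen that by (simp add: closedin_Un)
  next
    case False
    then have "?C s t = {x \<in> topspace (cantor_cube T). True}" by blast
    then show ?thesis using whole by simp
  qed
  have "char_fun T ` tree_paths T r = ?E \<inter> (\<Inter>s\<in>T. \<Inter>t\<in>T. ?D s t \<inter> ?C s t)"
    (is "?l = ?r")
  proof
    show "?l \<subseteq> ?r"
    proof clarify
      fix p assume p: "p \<in> tree_paths T r"
      have top: "char_fun T p \<in> topspace (cantor_cube T)"
        by (simp add: char_fun_def cantor_cube_def)
      have cf: "char_fun T p t \<longleftrightarrow> t \<in> p" if "t \<in> T" for t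
        using that by (simp add: char_fun_def)
      have "m \<in> p" using root_in_path[OF p m] by simp
      moreover have "char_fun T p \<in> ?D s t" if "s \<in> T" "t \<in> T" for s t
        using top cf that tree_pathsD(3)[OF p] by blast
      moreover have "char_fun T p \<in> ?C s t" if "s \<in> T" "t \<in> T" for s t
        using top cf that tree_pathsD(4)[OF p] by blast
      ultimately show "char_fun T p \<in> ?r"
        using top cf m(1) by blast
    qed
    show "?r \<subseteq> ?l"
    proof
      fix x assume x: "x \<in> ?r"
      let ?p = "{t \<in> T. x t}"
      \<comment> \<open>Off \<open>T\<close> both \<open>x\<close> and \<open>char_fun T ?p\<close>
        are \<open>undefined\<close>, so \<open>x\<close> is the characteristic function of its
        support.\<close>
      have "x \<in> extensional T" using x by (auto simp: cantor_cube_def PiE_def)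
      then have "x = char_fun T ?p"
        by (auto simp: char_fun_def extensional_def restrict_def fun_eq_iff)
      moreover have "?p \<in> tree_paths T r"
      proof -
        have "m \<in> ?p" using x m(1) by simp
        moreover have "s \<in> ?p" if "t \<in> ?p" "s \<in> T" "(s, t) \<in> r" for s t
          using x that by fastforce
        moreover have "(s, t) \<in> r \<or> (t, s) \<in> r" if "s \<in> ?p" "t \<in> ?p" for s t
          using x that by fastforce
        ultimately show ?thesis unfolding tree_paths_def by blast
      qed
      ultimately show "x \<in> ?l" by blast
    qed
  qed
  moreover have "closedin (cantor_cube T) ?r"
    using m(1) clopen(1)[OF m(1)] D C by (intro closedin_Int closedin_INT) auto
  ultimately show ?thesis
    unfolding path_space_def
    by (metis closedin_compact_space compact_space_cantor_cube compact_space_subtopology)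
qed

section \<open>From path spaces to ray spaces\<close>

text \<open>
  The lexicographic product of \<^term>\<open>T\<close> with the natural numbers. It has to live on the type
  \<^typ>\<open>'t\<close> again, so it is given by the coordinates of a bijection between \<^typ>\<open>'t\<close> and
  \<^typ>\<open>'t \<times> nat\<close>.
\<close>

definition omega_nodes :: "('t \<Rightarrow> 's) \<Rightarrow> 's set \<Rightarrow> 't set" where
  "omega_nodes b T = {x. b x \<in> T}"

definition omega_rel :: "('t \<Rightarrow> 's) \<Rightarrow> ('t \<Rightarrow> nat) \<Rightarrow> 's rel \<Rightarrow> 't rel" where
  "omega_rel b k r = {(x, y). (b x, b y) \<in> r \<and> (b x = b y \<longrightarrow> k x \<le> k y)}"

lemma bij_pair:
  assumes "bij (\<lambda>x. (b x, k x))"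
  shows bij_pair_ex: "\<exists>x. b x = t \<and> k x = n"
    and bij_pair_inj: "b x = b y \<Longrightarrow> k x = k y \<Longrightarrow> x = y"
proof -
  obtain z where "(t, n) = (b z, k z)"
    using surjD[OF bij_is_surj[OF assms]] by blast
  then show "\<exists>x. b x = t \<and> k x = n" by auto
  show "b x = b y \<Longrightarrow> k x = k y \<Longrightarrow> x = y"
    using injD[OF bij_is_inj[OF assms]] by simp
qed

text \<open>Inside one node the copies are ordered like the natural numbers, and across nodes the
  old order decides. Hence chains below a node stay chains, and well-foundedness comes from the
  lexicographic product.\<close>

lemma omega_order_tree:
  assumes T: "order_tree T r" and bij: "bij (\<lambda>x. (b x, k x))"
  shows "order_tree (omega_nodes b T) (omega_rel b k r)"
proof -
  note D = order_treeD[OF T]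
  note inj = bij_pair_inj[OF bij]
  obtain m where m: "m \<in> T" "\<And>t. t \<in> T \<Longrightarrow> (m, t) \<in> r"
    using D(8) by blast
  \<comment> \<open>The new root is the lowest copy of the old one.\<close>
  obtain m' where m': "b m' = m" "k m' = 0"
    using bij_pair_ex[OF bij] by blast
  show ?thesis
  proof (rule order_treeI[where m = m'])
    show "x \<in> omega_nodes b T \<and> y \<in> omega_nodes b T" if "(x, y) \<in> omega_rel b k r" for x y
      using that D(1,2) unfolding omega_nodes_def omega_rel_def by blast
    show "(x, x) \<in> omega_rel b k r" if "x \<in> omega_nodes b T" for x
      using that by (simp add: omega_nodes_def omega_rel_def D(3))
    show "(x, z) \<in> omega_rel b k r"
      if "(x, y) \<in> omega_rel b k r" "(y, z) \<in> omega_rel b k r" for x y z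
    proof -
      have xyz: "(b x, b y) \<in> r" "(b y, b z) \<in> r"
        and le: "b x = b y \<Longrightarrow> k x \<le> k y" "b y = b z \<Longrightarrow> k y \<le> k z"
        using that by (simp_all add: omega_rel_def)
      have "k x \<le> k z" if "b x = b z"
      proof -
        have "b x = b y" using xyz that by (intro D(5)) simp_all
        with le that show ?thesis by simp
      qed
      then show ?thesis
        using D(4)[OF xyz] by (simp add: omega_rel_def)
    qed
    show "x = y" if "(x, y) \<in> omega_rel b k r" "(y, x) \<in> omega_rel b k r" for x y
    proof -
      have "b x = b y" using that by (intro D(5)) (simp_all add: omega_rel_def)
      then show ?thesis using that by (intro inj) (simp_all add: omega_rel_def)
    qed
    have "omega_rel b k r - Id \<subseteq> inv_image ((r - Id) <*lex*> less_than) (\<lambda>x. (b x, k x))"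
    proof clarify
      fix x y assume xy: "(x, y) \<in> omega_rel b k r" "(x, y) \<notin> inv_image ((r - Id) <*lex*> less_than) (\<lambda>x. (b x, k x))"
      then have "b x = b y" "k x = k y" by (auto simp: omega_rel_def)
      then show "x = y" by (rule inj)
    qed
    then show "wf (omega_rel b k r - Id)"
      by (rule wf_subset[rotated]) (intro wf_inv_image wf_lex_prod wf_less_than D(6))
    show "(x, y) \<in> omega_rel b k r \<or> (y, x) \<in> omega_rel b k r"
      if "(x, z) \<in> omega_rel b k r" "(y, z) \<in> omega_rel b k r" for x y z
    proof -
      have "(b x, b y) \<in> r \<or> (b y, b x) \<in> r"
        using that by (intro D(7)[of "b x" "b z" "b y"]) (simp_all add: omega_rel_def)
      then show ?thesis
        unfolding omega_rel_def by (cases "b x = b y") auto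
    qed
    show "m' \<in> omega_nodes b T"
      using m m' by (simp add: omega_nodes_def)
    show "(m', t) \<in> omega_rel b k r" if "t \<in> omega_nodes b T" for t
      using that m m' by (simp add: omega_nodes_def omega_rel_def)
  qed
qed

text \<open>The copies with a fixed index \<open>n\<close> of the nodes of an antichain form an
  antichain again: comparable ones have the same first coordinate, hence coincide. There are
  countably many pairs of an antichain and an index.\<close>

lemma omega_special_tree:
  assumes T: "special_tree T r" and bij: "bij (\<lambda>x. (b x, k x))"
  shows "special_tree (omega_nodes b T) (omega_rel b k r)"
proof -
  obtain \<A> where A: "countable \<A>" "\<And>A. A \<in> \<A> \<Longrightarrow> tree_antichain T r A" "T = \<Union>\<A>"
    using T by (auto simp: special_tree_def)
  let ?B = "(\<lambda>(A, n). {x. b x \<in> A \<and> k x = n}) ` (\<A> \<times> UNIV)"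
  have "countable ?B"
    using A(1) by simp
  moreover have "\<forall>C\<in>?B. tree_antichain (omega_nodes b T) (omega_rel b k r) C"
  proof clarify
    fix A n assume "A \<in> \<A>"
    then have sub: "A \<subseteq> T" and anti: "\<And>s t. s \<in> A \<Longrightarrow> t \<in> A \<Longrightarrow> (s, t) \<in> r \<Longrightarrow> s = t"
      using A(2) unfolding tree_antichain_def by blast+
    show "tree_antichain (omega_nodes b T) (omega_rel b k r) {x. b x \<in> A \<and> k x = n}"
      unfolding tree_antichain_def
    proof (intro conjI ballI impI)
      show "{x. b x \<in> A \<and> k x = n} \<subseteq> omega_nodes b T"
        using sub unfolding omega_nodes_def by blast
      fix x y
      assume x: "x \<in> {x. b x \<in> A \<and> k x = n}" and y: "y \<in> {x. b x \<in> A \<and> k x = n}"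
        and "(x, y) \<in> omega_rel b k r"
      then have "(b x, b y) \<in> r" by (simp add: omega_rel_def)
      with x y have "b x = b y" by (intro anti) simp_all
      with x y show "x = y" by (intro bij_pair_inj[OF bij]) simp_all
    qed
  qed
  moreover have "omega_nodes b T = \<Union>?B"
    unfolding omega_nodes_def A(3) by blast
  moreover have "order_tree (omega_nodes b T) (omega_rel b k r)"
    using T by (intro omega_order_tree[OF _ bij]) (simp add: special_tree_def)
  ultimately show ?thesis
    unfolding special_tree_def by (intro conjI exI[of _ ?B])
qed

text \<open>The preimage of a path has no maximal element, since copy \<open>n\<close> of a node is
  followed by copy \<open>n + 1\<close>. Conversely, a ray that meets the copies of a node contains
  all of them, so it is the full preimage of its projection, and that projection is a path.\<close>

lemma omega_rays_bij:
  assumes T: "order_tree T r" and bij: "bij (\<lambda>x. (b x, k x))"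
  shows "bij_betw (\<lambda>p. {x \<in> omega_nodes b T. b x \<in> p})
           (tree_paths T r) (tree_rays (omega_nodes b T) (omega_rel b k r))"
proof -
  note D = order_treeD[OF T]
  note ex = bij_pair_ex[OF bij] and inj = bij_pair_inj[OF bij]
  have ray: "{x \<in> omega_nodes b T. b x \<in> p} \<in> tree_rays (omega_nodes b T) (omega_rel b k r)"
    (is "?q \<in> _") if p: "p \<in> tree_paths T r" for p
  proof -
    note P = tree_pathsD[OF p]
    have mem: "x \<in> ?q \<longleftrightarrow> b x \<in> p" for x
      using P(1) by (auto simp: omega_nodes_def)
    have "?q \<noteq> {}"
      using P(2) ex mem by (metis empty_iff ex_in_conv)
    moreover have "x \<in> ?q" if "y \<in> ?q" "x \<in> omega_nodes b T" "(x, y) \<in> omega_rel b k r" for x y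
      using that P(3)[of "b y" "b x"] mem by (simp add: omega_nodes_def omega_rel_def)
    moreover have "(x, y) \<in> omega_rel b k r \<or> (y, x) \<in> omega_rel b k r"
      if "x \<in> ?q" "y \<in> ?q" for x y
    proof -
      have "(b x, b y) \<in> r \<or> (b y, b x) \<in> r" "b x = b y \<longrightarrow> (b x, b y) \<in> r \<and> (b y, b x) \<in> r"
        using that mem P(4)[of "b x" "b y"] by auto
      then show ?thesis
        unfolding omega_rel_def by (cases "b x = b y") auto
    qed
    ultimately have "?q \<in> tree_paths (omega_nodes b T) (omega_rel b k r)"
      unfolding tree_paths_def by blast
    moreover have "\<exists>y\<in>?q. (x, y) \<in> omega_rel b k r \<and> y \<noteq> x" if "x \<in> ?q" for x
    proof -
      obtain y where "b y = b x" "k y = Suc (k x)" using ex by blast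
      then show ?thesis
        using that mem P(1) D(3) by (intro bexI[of _ y]) (auto simp: omega_rel_def)
    qed
    ultimately show ?thesis unfolding tree_rays_def by blast
  qed
  have surj: "\<exists>p\<in>tree_paths T r. {x \<in> omega_nodes b T. b x \<in> p} = q"
    if q: "q \<in> tree_rays (omega_nodes b T) (omega_rel b k r)" for q
  proof -
    have "q \<in> tree_paths (omega_nodes b T) (omega_rel b k r)"
      using q by (simp add: tree_rays_def)
    note Q = tree_pathsD[OF this]
    have qT: "b x \<in> T" if "x \<in> q" for x
      using Q(1) that by (auto simp: omega_nodes_def)
    have nomax: "\<exists>y\<in>q. (x, y) \<in> omega_rel b k r \<and> y \<noteq> x" if "x \<in> q" for x
      using q that unfolding tree_rays_def by blast
    \<comment> \<open>Copy 0 lies below every copy. Once copy \<open>n\<close> is in the ray, some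
      \<open>w\<close> in the ray is strictly above it: either a later copy of the same node or a
      copy of a larger node. In both cases copy \<open>n + 1\<close> lies below
      \<open>w\<close>.\<close>
    have full: "z \<in> q" if "x \<in> q" "b z = b x" "k z = n" for x z n
      using that(2,3)
    proof (induction n arbitrary: z)
      case 0
      then have "(z, x) \<in> omega_rel b k r" "z \<in> omega_nodes b T"
        using qT[OF \<open>x \<in> q\<close>] D(3) by (auto simp: omega_rel_def omega_nodes_def)
      then show ?case using Q(3) \<open>x \<in> q\<close> by blast
    next
      case (Suc n)
      obtain y where y: "b y = b x" "k y = n" using ex by blast
      then have "y \<in> q" using Suc.IH by simp
      from nomax[OF this] obtain w where w: "w \<in> q" "(y, w) \<in> omega_rel b k r" "w \<noteq> y"
        by blast
      then have "k w > n" if "b w = b y"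
        using inj[of w y] y that by (force simp: omega_rel_def)
      then have "(z, w) \<in> omega_rel b k r"
        using w(2) Suc.prems y by (auto simp: omega_rel_def)
      moreover have "z \<in> omega_nodes b T"
        using Suc.prems qT[OF \<open>x \<in> q\<close>] by (simp add: omega_nodes_def)
      ultimately show ?case using Q(3) w(1) by blast
    qed
    have "b ` q \<in> tree_paths T r"
    proof -
      have "s \<in> b ` q" if "x \<in> q" "s \<in> T" "(s, b x) \<in> r" for s x
      proof -
        \<comment> \<open>Copy 0 of \<open>s\<close> lies below \<open>x\<close> even when
          \<open>s = b x\<close>.\<close>
        obtain y where y: "b y = s" "k y = 0" using ex by blast
        then have "(y, x) \<in> omega_rel b k r" "y \<in> omega_nodes b T"
          using that by (auto simp: omega_rel_def omega_nodes_def)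
        then show ?thesis using Q(3) that(1) y(1) by blast
      qed
      moreover have "(b x, b y) \<in> r \<or> (b y, b x) \<in> r" if "x \<in> q" "y \<in> q" for x y
        using Q(4)[OF that] by (auto simp: omega_rel_def)
      ultimately show ?thesis
        using Q(2) qT unfolding tree_paths_def by blast
    qed
    moreover have "{x \<in> omega_nodes b T. b x \<in> b ` q} = q"
      using full Q(1) by blast
    ultimately show ?thesis by blast
  qed
  have "inj_on (\<lambda>p. {x \<in> omega_nodes b T. b x \<in> p}) (tree_paths T r)"
  proof (rule inj_onI)
    fix p q assume "p \<in> tree_paths T r" "q \<in> tree_paths T r"
      and eq: "{x \<in> omega_nodes b T. b x \<in> p} = {x \<in> omega_nodes b T. b x \<in> q}"
    then have "p \<subseteq> T" "q \<subseteq> T" by (auto dest: tree_pathsD)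
    moreover have "t \<in> p \<longleftrightarrow> t \<in> q" if "t \<in> T" for t
    proof -
      obtain x where "b x = t" using ex by blast
      with eq that show ?thesis unfolding omega_nodes_def by blast
    qed
    ultimately show "p = q" by blast
  qed
  with ray surj show ?thesis
    unfolding bij_betw_def by blast
qed

lemma omega_homeomorphic:
  assumes T: "order_tree T r" and bij: "bij (\<lambda>x. (b x, k x))"
  shows "path_space T r homeomorphic_space ray_space (omega_nodes b T) (omega_rel b k r)"
  unfolding path_space_def ray_space_def
proof (rule cube_subspaces_homeomorphic[OF _ _ _ _ omega_rays_bij[OF T bij]])
  show "compact_space (subtopology (cantor_cube T) (char_fun T ` tree_paths T r))"
    using compact_space_path_space[OF T] by (simp add: path_space_def)
qed (auto simp: tree_rays_def tree_paths_def omega_nodes_def)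

text \<open>An infinite cardinal absorbs a countable factor, so the type has room for countably many
  copies of each node of a tree on it.\<close>

lemma infinite_bij_times_nat:
  assumes "infinite (UNIV :: 't set)"
  obtains b :: "'t \<Rightarrow> 't" and k :: "'t \<Rightarrow> nat" where "bij (\<lambda>x. (b x, k x))"
proof -
  have "(card_of (UNIV :: 't set), card_of ((UNIV :: 't set) \<times> (UNIV :: nat set))) \<in> ordIso"
    using assms by (intro card_of_Times_infinite_simps) (auto simp: infinite_iff_card_of_nat)
  then obtain f :: "'t \<Rightarrow> 't \<times> nat" where "bij f"
    unfolding card_of_ordIso[symmetric] by auto
  then show thesis
    using that[of "fst \<circ> f" "snd \<circ> f"] by simp
qed

section \<open>From compact ray spaces to path spaces\<close>

text \<open>A ray is assumed to exist because the root has to survive the removal of nodes that lie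
  on no ray. Without rays the ray space is empty, whereas the path space of a tree contains at least
  the path consisting of the root.\<close>

locale contracted_tree =
  fixes T :: "'t set" and r :: "'t rel"
  assumes tree: "order_tree T r" and rays_nonempty: "tree_rays T r \<noteq> {}"
begin

definition core :: "'t set" where
  "core = \<Union>(tree_rays T r)"

text \<open>Phrased through all predecessors of \<open>u\<close>, so that the uniqueness of
  predecessors, and of successors within a chain, follows from antisymmetry alone.\<close>

definition successor :: "'t \<Rightarrow> 't \<Rightarrow> bool" where
  "successor t u \<longleftrightarrow> (t, u) \<in> r \<and> u \<noteq> t \<and> (\<forall>s. (s, u) \<in> r \<longrightarrow> s = u \<or> (s, t) \<in> r)"

definition next_node :: "'t \<Rightarrow> 't" where
  "next_node t = (SOME u. u \<in> core \<and> successor t u)"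

text \<open>
  Contracting every edge from \<^term>\<open>t\<close> to \<^term>\<open>next_node t\<close> leaves the root, the limit nodes and
  the other successors.
\<close>

definition nodes :: "'t set" where
  "nodes = core - next_node ` core"

definition rel :: "'t rel" where
  "rel = r \<inter> (nodes \<times> nodes)"

lemmas order = order_treeD[OF tree]

section \<open>Rays and immediate successors\<close>

lemma rayD:
  assumes "p \<in> tree_rays T r"
  shows "p \<subseteq> T" "p \<noteq> {}" "t \<in> p \<Longrightarrow> (s, t) \<in> r \<Longrightarrow> s \<in> p"
    "s \<in> p \<Longrightarrow> t \<in> p \<Longrightarrow> (s, t) \<in> r \<or> (t, s) \<in> r"
    "p \<subseteq> core"
proof -
  have "p \<in> tree_paths T r" using assms by (simp add: tree_rays_def)
  from tree_pathsD[OF this] order(1)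
  show "p \<subseteq> T" "p \<noteq> {}" "t \<in> p \<Longrightarrow> (s, t) \<in> r \<Longrightarrow> s \<in> p"
    "s \<in> p \<Longrightarrow> t \<in> p \<Longrightarrow> (s, t) \<in> r \<or> (t, s) \<in> r"
    by blast+
  show "p \<subseteq> core" using assms by (auto simp: core_def)
qed

lemma rayI:
  assumes "p \<subseteq> T" "p \<noteq> {}" "\<And>s t. t \<in> p \<Longrightarrow> (s, t) \<in> r \<Longrightarrow> s \<in> p"
    "\<And>s t. s \<in> p \<Longrightarrow> t \<in> p \<Longrightarrow> (s, t) \<in> r \<or> (t, s) \<in> r"
    "\<And>s. s \<in> p \<Longrightarrow> \<exists>t\<in>p. (s, t) \<in> r \<and> t \<noteq> s"
  shows "p \<in> tree_rays T r"
proof -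
  have "p \<in> tree_paths T r" unfolding tree_paths_def using assms(1-4) by blast
  then show ?thesis unfolding tree_rays_def using assms(5) by blast
qed

lemma core_subset: "core \<subseteq> T"
  using rayD(1) by (auto simp: core_def)

lemma core_downclosed: "t \<in> core \<Longrightarrow> (s, t) \<in> r \<Longrightarrow> s \<in> core"
  unfolding core_def using rayD(3) by blast

text \<open>As \<open>t\<close> is not maximal in the ray, well-foundedness provides a least node
  \<open>u\<close> of the ray strictly above \<open>t\<close>. Anything strictly below
  \<open>u\<close> is in the ray but not strictly above \<open>t\<close>, hence is at most
  \<open>t\<close>.\<close>

lemma ray_successor:
  assumes p: "p \<in> tree_rays T r" and t: "t \<in> p"
  obtains u where "u \<in> p" "successor t u"
proof -
  have "{u \<in> p. (t, u) \<in> r \<and> u \<noteq> t} \<noteq> {}"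
    using p t unfolding tree_rays_def by blast
  then obtain u where u: "u \<in> p" "(t, u) \<in> r" "u \<noteq> t"
    and min: "\<And>s. (s, u) \<in> r - Id \<Longrightarrow> s \<notin> {u \<in> p. (t, u) \<in> r \<and> u \<noteq> t}"
    by (rule wfE_min'[OF order(6)]) blast
  have "s = u \<or> (s, t) \<in> r" if s: "(s, u) \<in> r" for s
  proof (cases "s = u \<or> s = t")
    case True
    then show ?thesis using order(3) rayD(1)[OF p] t by blast
  next
    case False
    have "s \<in> p" using rayD(3)[OF p u(1) s] .
    then have "(t, s) \<notin> r" using min[of s] s False by blast
    then show ?thesis using rayD(4)[OF p \<open>s \<in> p\<close> t] by blast
  qed
  with u have "successor t u" by (auto simp: successor_def)
  with u(1) show thesis by (rule that)
qed

text \<open>A node of \<open>core\<close> lies on a ray, which passes on to an immediate successor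
  inside \<open>core\<close>; so the choice has a witness.\<close>

lemma next_node:
  assumes "t \<in> core"
  shows "next_node t \<in> core" "successor t (next_node t)"
proof -
  obtain p where p: "p \<in> tree_rays T r" "t \<in> p" using assms by (auto simp: core_def)
  obtain u where "u \<in> p" "successor t u" using ray_successor[OF p] .
  then have "\<exists>u. u \<in> core \<and> successor t u" using rayD(5)[OF p(1)] by blast
  then show "next_node t \<in> core" "successor t (next_node t)"
    unfolding next_node_def by (metis (mono_tags, lifting) someI_ex)+
qed

lemma successor_eq:
  assumes "successor t u" "successor t v" "(u, v) \<in> r \<or> (v, u) \<in> r"
  shows "u = v"
  using assms order(5) unfolding successor_def by metis

lemma predecessor_eq:
  assumes "successor s u" "successor t u"
  shows "s = t"
  using assms order(5) unfolding successor_def by metis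

text \<open>The root lies on every ray, and having nothing strictly below it, it is not the
  successor of any node; so it is not contracted away.\<close>

lemma root_in_nodes:
  "\<exists>m\<in>nodes. \<forall>t\<in>T. (m, t) \<in> r"
proof -
  obtain m where m: "m \<in> T" "\<And>t. t \<in> T \<Longrightarrow> (m, t) \<in> r"
    using order(8) by blast
  obtain p where p: "p \<in> tree_rays T r" using rays_nonempty by blast
  then have "m \<in> core"
    using rayD(2)[OF p] rayD(1,5)[OF p] m core_downclosed by blast
  moreover have "m \<noteq> next_node t" if "t \<in> core" for t
    using next_node(2)[OF that] m order(5) core_subset that unfolding successor_def by blast
  ultimately have "m \<in> nodes" by (auto simp: nodes_def)
  then show ?thesis using m(2) by blast
qed

section \<open>The contracted tree\<close>

lemma nodes_subset: "nodes \<subseteq> core" "nodes \<subseteq> T"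
  using core_subset by (auto simp: nodes_def)

lemma contracted_order_tree: "order_tree nodes rel"
proof -
  obtain m where m: "m \<in> nodes" "\<And>t. t \<in> T \<Longrightarrow> (m, t) \<in> r"
    using root_in_nodes by blast
  show ?thesis
  proof (rule order_treeI)
    show "wf (rel - Id)"
      by (rule wf_subset[OF order(6)]) (auto simp: rel_def)
    show "m \<in> nodes" by (rule m)
    show "(m, t) \<in> rel" if "t \<in> nodes" for t
      using m that nodes_subset by (auto simp: rel_def)
    show "(x, y) \<in> rel \<Longrightarrow> x \<in> nodes \<and> y \<in> nodes" for x y
      by (simp add: rel_def)
    show "x \<in> nodes \<Longrightarrow> (x, x) \<in> rel" for x
      using order(3) nodes_subset by (auto simp: rel_def)
    show "(x, y) \<in> rel \<Longrightarrow> (y, z) \<in> rel \<Longrightarrow> (x, z) \<in> rel" for x y z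
      using order(4) unfolding rel_def by blast
    show "(x, y) \<in> rel \<Longrightarrow> (y, x) \<in> rel \<Longrightarrow> x = y" for x y
      using order(5) unfolding rel_def by blast
    show "(x, z) \<in> rel \<Longrightarrow> (y, z) \<in> rel \<Longrightarrow> (x, y) \<in> rel \<or> (y, x) \<in> rel" for x y z
      using order(7) unfolding rel_def by blast
  qed
qed

lemma contracted_special_tree:
  assumes "special_tree T r"
  shows "special_tree nodes rel"
proof -
  obtain \<A> where A: "countable \<A>" "\<And>A. A \<in> \<A> \<Longrightarrow> tree_antichain T r A" "T = \<Union>\<A>"
    using assms by (auto simp: special_tree_def)
  have "countable ((\<lambda>A. A \<inter> nodes) ` \<A>)" using A(1) by simp
  moreover have "tree_antichain nodes rel (A \<inter> nodes)" if "A \<in> \<A>" for A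
    using A(2)[OF that] unfolding tree_antichain_def rel_def by blast
  moreover have "nodes = \<Union>((\<lambda>A. A \<inter> nodes) ` \<A>)"
    using A(3) nodes_subset by blast
  ultimately show ?thesis
    using contracted_order_tree unfolding special_tree_def by blast
qed

section \<open>Traces of rays on the surviving nodes\<close>

lemma ray_trace_path:
  assumes p: "p \<in> tree_rays T r"
  shows "{t \<in> nodes. t \<in> p} \<in> tree_paths nodes rel"
proof -
  obtain m where m: "m \<in> nodes" "\<And>t. t \<in> T \<Longrightarrow> (m, t) \<in> r"
    using root_in_nodes by blast
  have "m \<in> p" using rayD(1-3)[OF p] m(2) by blast
  then show ?thesis
    using m(1) rayD(3,4)[OF p] unfolding tree_paths_def rel_def by blast
qed

text \<open>
  At the least node of a ray outside another ray, the two rays branch off from a common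
  predecessor, and at most one of the two branches is contracted.
\<close>

lemma ray_trace_subset:
  assumes p: "p \<in> tree_rays T r" and q: "q \<in> tree_rays T r"
    and eq: "{t \<in> nodes. t \<in> p} = {t \<in> nodes. t \<in> q}"
  shows "p \<subseteq> q"
proof (rule ccontr)
  assume "\<not> p \<subseteq> q"
  then have "p - q \<noteq> {}" by blast
  then obtain s where s: "s \<in> p" "s \<notin> q"
    and min: "\<And>t. (t, s) \<in> r - Id \<Longrightarrow> t \<notin> p - q"
    by (rule wfE_min'[OF order(6)]) blast
  have "s \<notin> nodes" using s eq by blast
  moreover have "s \<in> core" using rayD(5)[OF p] s(1) by blast
  ultimately obtain t where t: "t \<in> core" "s = next_node t"
    by (auto simp: nodes_def)
  have st: "successor t s" using next_node(2)[OF t(1)] t(2) by simp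
  then have ts: "(t, s) \<in> r - Id" by (auto simp: successor_def)
  then have "t \<in> q" using min[OF ts] rayD(3)[OF p s(1)] by blast
  with q obtain u where u: "u \<in> q" "successor t u"
    using ray_successor by blast
  have "u \<notin> p"
    using successor_eq[OF st u(2)] rayD(4)[OF p s(1)] s(2) u(1) by blast
  \<comment> \<open>The traces agree, so \<open>u\<close> has been contracted as well. Its only
    immediate predecessor is \<open>t\<close>, which forces \<open>u = next_node t = s\<close>,
    although \<open>s\<close> is not in \<open>q\<close>.\<close>
  then have "u \<notin> nodes" using u(1) eq by blast
  moreover have "u \<in> core" using rayD(5)[OF q] u(1) by blast
  ultimately obtain t' where t': "t' \<in> core" "u = next_node t'"
    by (auto simp: nodes_def)
  have "t' = t"
    using predecessor_eq[of t' u t] next_node(2)[OF t'(1)] t'(2) u(2) by simp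
  then show False using t t' u(1) s(2) by simp
qed

section \<open>Extending paths to rays\<close>

lemma iterate_next:
  assumes "t \<in> core"
  shows "(next_node ^^ n) t \<in> core"
  using assms next_node(1) by (induction n) auto

lemma iterate_next_mono:
  assumes "t \<in> core" "i \<le> j"
  shows "((next_node ^^ i) t, (next_node ^^ j) t) \<in> r"
  using assms(2)
proof (induction j rule: dec_induct)
  case base
  show ?case using iterate_next[OF assms(1)] core_subset order(3) by blast
next
  case (step j)
  have "((next_node ^^ j) t, (next_node ^^ Suc j) t) \<in> r"
    using next_node(2)[OF iterate_next[OF assms(1)]] by (auto simp: successor_def)
  then show ?case using step.IH order(4) by blast
qed

text \<open>A surviving node is never a value of \<open>next_node\<close> on \<open>core\<close>, so
  if it lies below such a value it already lies below the predecessor; descend one step at a time.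
  Following chosen successors thus adds nothing to a trace.\<close>

lemma node_below_iterate:
  assumes "t \<in> core" "s \<in> nodes" "(s, (next_node ^^ n) t) \<in> r"
  shows "(s, t) \<in> r"
  using assms(3)
proof (induction n)
  case (Suc n)
  let ?u = "(next_node ^^ n) t"
  have u: "?u \<in> core" using iterate_next[OF assms(1)] .
  have "s \<noteq> next_node ?u" using assms(2) u by (auto simp: nodes_def)
  then have "(s, ?u) \<in> r"
    using Suc.prems next_node(2)[OF u] by (auto simp: successor_def)
  then show ?case by (rule Suc.IH)
qed simp

text \<open>A path with a greatest node has to be prolonged, and the chosen successors do so without
  changing the trace. A path without one is cofinal in a ray already.\<close>

lemma path_is_trace:
  assumes q: "q \<in> tree_paths nodes rel"
  shows "\<exists>p\<in>tree_rays T r. {t \<in> nodes. t \<in> p} = q"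
proof -
  have qn: "q \<subseteq> nodes" and qne: "q \<noteq> {}"
    and qd: "\<And>s t. t \<in> q \<Longrightarrow> s \<in> nodes \<Longrightarrow> (s, t) \<in> r \<Longrightarrow> s \<in> q"
    and qc: "\<And>s t. s \<in> q \<Longrightarrow> t \<in> q \<Longrightarrow> (s, t) \<in> r \<or> (t, s) \<in> r"
    using tree_pathsD[OF q] unfolding rel_def by blast+
  show ?thesis
  proof (cases "\<exists>m\<in>q. \<forall>t\<in>q. (t, m) \<in> r")
    case True
    then obtain m where m: "m \<in> q" "\<And>t. t \<in> q \<Longrightarrow> (t, m) \<in> r" by blast
    have mc: "m \<in> core" using m(1) qn nodes_subset by blast
    \<comment> \<open>The down-closure in \<open>T\<close> of the sequence of iterated chosen
      successors of \<open>m\<close>.\<close>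
    define p where "p = {s. \<exists>n. (s, (next_node ^^ n) m) \<in> r}"
    have iter: "(next_node ^^ n) m \<in> p" for n
      using iterate_next_mono[OF mc, of n n] by (auto simp: p_def)
    have "p \<in> tree_rays T r"
    proof (rule rayI)
      show "p \<subseteq> T" using order(1) by (auto simp: p_def)
      show "p \<noteq> {}" using iter by blast
      show "s \<in> p" if "t \<in> p" "(s, t) \<in> r" for s t
        using that order(4) unfolding p_def by blast
      show "(s, t) \<in> r \<or> (t, s) \<in> r" if st: "s \<in> p" "t \<in> p" for s t
      proof -
        obtain i j where "(s, (next_node ^^ i) m) \<in> r" "(t, (next_node ^^ j) m) \<in> r"
          using st unfolding p_def by blast
        then have "(s, (next_node ^^ max i j) m) \<in> r" "(t, (next_node ^^ max i j) m) \<in> r"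
          using iterate_next_mono[OF mc, of i "max i j"] iterate_next_mono[OF mc, of j "max i j"]
            order(4) by (meson max.cobounded1 max.cobounded2)+
        then show ?thesis by (rule order(7))
      qed
      show "\<exists>t\<in>p. (s, t) \<in> r \<and> t \<noteq> s" if s: "s \<in> p" for s
      proof -
        obtain n where n: "(s, (next_node ^^ n) m) \<in> r" using s by (auto simp: p_def)
        let ?u = "(next_node ^^ n) m"
        have "(?u, next_node ?u) \<in> r" "next_node ?u \<noteq> ?u"
          using next_node(2)[OF iterate_next[OF mc]] by (auto simp: successor_def)
        then have "(s, next_node ?u) \<in> r" "next_node ?u \<noteq> s"
          using n order(4,5) by blast+
        then show ?thesis using iter[of "Suc n"] by auto
      qed
    qed
    moreover have "{t \<in> nodes. t \<in> p} = q"
    proof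
      show "{t \<in> nodes. t \<in> p} \<subseteq> q"
        using node_below_iterate[OF mc] qd[OF m(1)] unfolding p_def by blast
      have "t \<in> p" if "t \<in> q" for t
        using m(2)[OF that] unfolding p_def by (auto intro: exI[of _ 0])
      then show "q \<subseteq> {t \<in> nodes. t \<in> p}" using qn by blast
    qed
    ultimately show ?thesis by blast
  next
    case False
    \<comment> \<open>The down-closure of \<open>q\<close> in \<open>T\<close> restores the
      contracted nodes below \<open>q\<close>; it has no maximal element because \<open>q\<close>
      has no greatest one.\<close>
    define p where "p = {s. \<exists>u\<in>q. (s, u) \<in> r}"
    have qp: "q \<subseteq> p"
      using qn nodes_subset order(3) unfolding p_def by blast
    have "p \<in> tree_rays T r"
    proof (rule rayI)
      show "p \<subseteq> T" using order(1) by (auto simp: p_def)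
      show "p \<noteq> {}" using qp qne by blast
      show "s \<in> p" if "t \<in> p" "(s, t) \<in> r" for s t
        using that order(4) unfolding p_def by blast
      show "(s, t) \<in> r \<or> (t, s) \<in> r" if st: "s \<in> p" "t \<in> p" for s t
      proof -
        obtain u v where "u \<in> q" "(s, u) \<in> r" "v \<in> q" "(t, v) \<in> r"
          using st unfolding p_def by blast
        then obtain w where "(s, w) \<in> r" "(t, w) \<in> r"
          using qc order(4) by metis
        then show ?thesis by (rule order(7))
      qed
      show "\<exists>t\<in>p. (s, t) \<in> r \<and> t \<noteq> s" if s: "s \<in> p" for s
      proof -
        obtain u where u: "u \<in> q" "(s, u) \<in> r" using s by (auto simp: p_def)
        obtain v where v: "v \<in> q" "(v, u) \<notin> r" using False u(1) by blast
        then have "(u, v) \<in> r" using qc u(1) by blast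
        then have "(s, v) \<in> r" using order(4) u(2) by blast
        moreover have "v \<noteq> s" using u(2) v(2) by blast
        ultimately show ?thesis using v(1) qp by blast
      qed
    qed
    moreover have "{t \<in> nodes. t \<in> p} = q"
      using qp qn qd unfolding p_def by blast
    ultimately show ?thesis by blast
  qed
qed

lemma trace_bij: "bij_betw (\<lambda>p. {t \<in> nodes. t \<in> p}) (tree_rays T r) (tree_paths nodes rel)"
  unfolding bij_betw_def
proof
  show "inj_on (\<lambda>p. {t \<in> nodes. t \<in> p}) (tree_rays T r)"
    by (rule inj_onI, rule subset_antisym) (auto dest: ray_trace_subset)
  show "(\<lambda>p. {t \<in> nodes. t \<in> p}) ` tree_rays T r = tree_paths nodes rel"
    using ray_trace_path path_is_trace by blast
qed

text \<open>The pullback is along the inclusion of \<open>nodes\<close> into \<open>T\<close>. Its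
  domain is the ray space, and this is where the compactness of that space enters.\<close>

lemma contracted_homeomorphic:
  assumes "compact_space (ray_space T r)"
  shows "ray_space T r homeomorphic_space path_space nodes rel"
  unfolding path_space_def ray_space_def
proof (rule cube_subspaces_homeomorphic[OF _ _ _ _ trace_bij])
  show "compact_space (subtopology (cantor_cube T) (char_fun T ` tree_rays T r))"
    using assms by (simp add: ray_space_def)
  show "t \<in> nodes \<Longrightarrow> t \<in> T" for t using nodes_subset by blast
qed (auto simp: tree_rays_def tree_paths_def)

end

section \<open>The equivalence\<close>

text \<open>Compactness of the new ray space is transported from the path space. The conditional
  clause on specialness lets one construction serve both equivalences.\<close>

lemma path_space_imp_compact_ray_space:
  fixes T :: "'t set"
  assumes inf: "infinite (UNIV :: 't set)" and T: "order_tree T r"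
    and X: "X homeomorphic_space path_space T r"
  obtains T' :: "'t set" and r' where "order_tree T' r'" "special_tree T r \<Longrightarrow> special_tree T' r'"
    "compact_space (ray_space T' r')" "X homeomorphic_space ray_space T' r'"
proof -
  obtain b :: "'t \<Rightarrow> 't" and k :: "'t \<Rightarrow> nat" where bij: "bij (\<lambda>x. (b x, k x))"
    using infinite_bij_times_nat[OF inf] .
  note hom = omega_homeomorphic[OF T bij]
  show thesis
  proof (rule that)
    show "order_tree (omega_nodes b T) (omega_rel b k r)"
      by (rule omega_order_tree[OF T bij])
    show "special_tree (omega_nodes b T) (omega_rel b k r)" if "special_tree T r"
      by (rule omega_special_tree[OF that bij])
    show "compact_space (ray_space (omega_nodes b T) (omega_rel b k r))"
      using homeomorphic_compact_space[OF hom] compact_space_path_space[OF T] by simp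
    show "X homeomorphic_space ray_space (omega_nodes b T) (omega_rel b k r)"
      using homeomorphic_space_trans[OF X hom] .
  qed
qed

lemma compact_ray_space_imp_path_space:
  fixes T :: "'t set"
  assumes ne: "topspace X \<noteq> {}" and T: "order_tree T r"
    and compact: "compact_space (ray_space T r)" and X: "X homeomorphic_space ray_space T r"
  obtains T' :: "'t set" and r' where "order_tree T' r'" "special_tree T r \<Longrightarrow> special_tree T' r'"
    "X homeomorphic_space path_space T' r'"
proof -
  have "topspace (ray_space T r) \<noteq> {}"
    using homeomorphic_empty_space[OF X] ne by simp
  \<comment> \<open>A point of \<open>X\<close> yields a point of the ray space, hence the ray that
    the contraction requires.\<close>
  then interpret contracted_tree T r
    using T by unfold_locales (auto simp: topspace_ray_space)
  show thesis
    using that[OF contracted_order_tree contracted_special_tree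
      homeomorphic_space_trans[OF X contracted_homeomorphic[OF compact]]] .
qed

text \<open>All trees live on one type \<open>'t\<close>, whose infinitude makes room for the copies
  of nodes. Nonemptiness of \<open>X\<close> excludes ray spaces of trees without rays, which are
  empty and compact but no path spaces.\<close>

theorem theorem3p9:
  fixes X :: "'a topology"
  assumes "topspace X \<noteq> {}"
    and "infinite (UNIV :: 't set)"
  shows "((\<exists>(T :: 't set) r. order_tree T r \<and> X homeomorphic_space path_space T r) \<longleftrightarrow>
          (\<exists>(T :: 't set) r. order_tree T r \<and> compact_space (ray_space T r) \<and>
             X homeomorphic_space ray_space T r))
       \<and> ((\<exists>(T :: 't set) r. special_tree T r \<and> X homeomorphic_space path_space T r) \<longleftrightarrow>
          (\<exists>(T :: 't set) r. special_tree T r \<and> compact_space (ray_space T r) \<and>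
             X homeomorphic_space ray_space T r))"
proof -
  have special: "order_tree T r" if "special_tree T r" for T :: "'t set" and r
    using that by (simp add: special_tree_def)
  show ?thesis
  proof (intro conjI iffI; elim exE conjE)
    fix T :: "'t set" and r
    assume "order_tree T r" "X homeomorphic_space path_space T r"
    then show "\<exists>(T :: 't set) r. order_tree T r \<and> compact_space (ray_space T r) \<and>
        X homeomorphic_space ray_space T r"
      using path_space_imp_compact_ray_space[OF assms(2)] by metis
  next
    fix T :: "'t set" and r
    assume "order_tree T r" "compact_space (ray_space T r)" "X homeomorphic_space ray_space T r"
    then show "\<exists>(T :: 't set) r. order_tree T r \<and> X homeomorphic_space path_space T r"
      using compact_ray_space_imp_path_space[OF assms(1)] by metis
  next
    fix T :: "'t set" and r
    assume "special_tree T r" "X homeomorphic_space path_space T r"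
    then show "\<exists>(T :: 't set) r. special_tree T r \<and> compact_space (ray_space T r) \<and>
        X homeomorphic_space ray_space T r"
      using path_space_imp_compact_ray_space[OF assms(2) special] by metis
  next
    fix T :: "'t set" and r
    assume "special_tree T r" "compact_space (ray_space T r)" "X homeomorphic_space ray_space T r"
    then show "\<exists>(T :: 't set) r. special_tree T r \<and> X homeomorphic_space path_space T r"
      using compact_ray_space_imp_path_space[OF assms(1) special] by metis
  qed
qed

end
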